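(* Let $f:\mathbb{R}^d\to\mathbb{R}$ satisfy Assumption A1 (with constants $L,L_H$ and starting point $\boldsymbol\theta_0$) and Assumption A2 (with constants $\mu,\eta$), see context, and let $(\boldsymbol\theta_n)_{n\ge0}$ be generated by the RON iteration. Assume further that $\overline\varepsilon=0$. Let $N_1:=N(\gamma_1)$ with $\gamma_1:=\min\left\{0.2,\ \frac{20}{33}\frac{\mu}{1.2\mu+\overline\varepsilon}\right\}$. Then almost surely, for any $n\ge N_1$, $$\|\nabla f(\boldsymbol\theta_{n+1})\|\le\frac{25}{12}\,\frac{\sqrt{L_H}}{\mu}\,\|\nabla f(\boldsymbol\theta_n)\|^{3/2}.$$ In particular, for $n$ sufficiently large one has superlinear local convergence (of the gradient norms to $0$).
   Context: Norms: $\|\cdot\|$ is the Euclidean norm for vectors, $\|\cdot\|_2$ the spectral norm for matrices; $\mathbf A\succeq\mathbf B$ means $\mathbf A-\mathbf B$ is symmetric positive semi-definite. Assumption A1: $f:\mathbb{R}^d\to\mathbb{R}$ is convex, twice continuously differentiable, $f^*:=\inf f>-\infty$, and for constants $L,L_H>0$ and $\mathcal L:=\{\boldsymbol\theta: f(\boldsymbol\theta)\le f(\boldsymbol\theta_0)\}$ one has $\|\nabla f(\boldsymbol\theta)-\nabla f(\boldsymbol\theta')\|\le L\|\boldsymbol\theta-\boldsymbol\theta'\|$ and $\|\nabla^2 f(\boldsymbol\theta)-\nabla^2 f(\boldsymbol\theta')\|_2\le L_H\|\boldsymbol\theta-\boldsymbol\theta'\|$ for all $\boldsymbol\theta,\boldsymbol\theta'\in\mathcal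 L$; moreover $\mathcal L$ is compact with diameter $D$. Assumption A2 (local quadratic growth): with $\mathcal S:=\arg\min f$, there exist $\mu>0$ and $\eta>0$ such that for every $\boldsymbol\theta_*\in\mathcal S$, $f(\boldsymbol\theta)-f(\boldsymbol\theta_* )\ge\frac{\mu}{2}\,\mathrm{dist}(\boldsymbol\theta,\mathcal S)^2$ for all $\boldsymbol\theta$ with $\|\nabla f(\boldsymbol\theta)\|\le\eta$. Hessian overestimation oracle: a (possibly randomized) map $\boldsymbol\theta\mapsto\hat{\mathbf B}(\boldsymbol\theta;\omega)$, with randomness $\omega\in\Omega$, such that almost surely $\hat{\mathbf B}(\boldsymbol\theta;\omega)\succeq\nabla^2 f(\boldsymbol\theta)$. Set $\overline\varepsilon:=\sup_{\omega\in\Omega}\sup_{\boldsymbol\theta\in\mathcal L}\|\hat{\mathbf B}(\boldsymbol\theta;\omega)-\nabla^2 f(\boldsymbol\theta)\|_2$. RON (Regularized Overestimated Newton) iteration: at step $n$ call the oracle at $\boldsymbol\theta_n$ to get $\hat{\mathbf B}_n\succeq\nabla^2 f(\boldsymbol\theta_n)$, and set $$\boldsymbol\theta_{n+1}=\boldsymbol\theta_n-(\hat{\mathbf B}_n+\lambda_n\mathbf I)^{-1}\nabla f(\boldsymbol\theta_n),\qquad \lambda_n=\sqrt{L_H\|\nabla f(\boldsymbol\theta_n)\|}$$ (if $\nabla f(\boldsymbol\theta_n)=0$, then $\boldsymbol\theta_{n+1}=\boldsymbol\theta_n$). Random time: for $\gamma>0$, $N(\gamma):=\inf\{n\ge0:\|\nabla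 f(\boldsymbol\theta_n)\|<\min\{(\gamma\mu)^2/L_H,\ \eta\}\}$, with $\inf\emptyset=\infty$. A nonnegative sequence $(g_n)$ converges superlinearly to $0$ if $g_n\to 0$ and $g_{n+1}\le\rho_n g_n$ for some $\rho_n\to0$. *)

theory Defs
  imports "HOL-Probability.Probability"
begin

definition grad :: "(real ^ 'd \<Rightarrow> real) \<Rightarrow> real ^ 'd \<Rightarrow> real ^ 'd" where
  "grad f x = (\<chi> i. frechet_derivative f (at x) (axis i 1))"

definition hess :: "(real ^ 'd \<Rightarrow> real) \<Rightarrow> real ^ 'd \<Rightarrow> real ^ 'd ^ 'd" where
  "hess f x = jacobian (grad f) (at x)"

definition twice_continuously_differentiable :: "(real ^ 'd \<Rightarrow> real) \<Rightarrow> bool" where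
  "twice_continuously_differentiable f \<longleftrightarrow>
     (\<forall>x. f differentiable (at x)) \<and> (\<forall>x. grad f differentiable (at x)) \<and>
     continuous_on UNIV (hess f)"

definition spectral_norm :: "real ^ 'd ^ 'd \<Rightarrow> real" where
  "spectral_norm A = onorm (\<lambda>v. A *v v)"

definition psd :: "real ^ 'd ^ 'd \<Rightarrow> bool" where
  "psd A \<longleftrightarrow> transpose A = A \<and> (\<forall>v. 0 \<le> v \<bullet> (A *v v))"

definition loewner_ge :: "real ^ 'd ^ 'd \<Rightarrow> real ^ 'd ^ 'd \<Rightarrow> bool" (infix \<open>\<succeq>\<close> 50) where
  "A \<succeq> B \<longleftrightarrow> psd (A - B)"

definition sublevel :: "(real ^ 'd \<Rightarrow> real) \<Rightarrow> real ^ 'd \<Rightarrow> (real ^ 'd) set" where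
  "sublevel f \<theta>\<^sub>0 = {\<theta>. f \<theta> \<le> f \<theta>\<^sub>0}"

definition minimizers :: "(real ^ 'd \<Rightarrow> real) \<Rightarrow> (real ^ 'd) set" where
  "minimizers f = {\<theta>. is_arg_min f (\<lambda>_. True) \<theta>}"

definition assumption_A1 ::
    "(real ^ 'd \<Rightarrow> real) \<Rightarrow> real ^ 'd \<Rightarrow> real \<Rightarrow> real \<Rightarrow> real \<Rightarrow> bool" where
  "assumption_A1 f \<theta>\<^sub>0 L L\<^sub>H D \<longleftrightarrow>
     convex_on UNIV f \<and> twice_continuously_differentiable f \<and> bdd_below (range f) \<and>
     L > 0 \<and> L\<^sub>H > 0 \<and>
     (\<forall>\<theta>\<in>sublevel f \<theta>\<^sub>0. \<forall>\<theta>'\<in>sublevel f \<theta>\<^sub>0.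
        norm (grad f \<theta> - grad f \<theta>') \<le> L * norm (\<theta> - \<theta>') \<and>
        spectral_norm (hess f \<theta> - hess f \<theta>') \<le> L\<^sub>H * norm (\<theta> - \<theta>')) \<and>
     compact (sublevel f \<theta>\<^sub>0) \<and> diameter (sublevel f \<theta>\<^sub>0) = D"

definition assumption_A2 :: "(real ^ 'd \<Rightarrow> real) \<Rightarrow> real \<Rightarrow> real \<Rightarrow> bool" where
  "assumption_A2 f \<mu> \<eta> \<longleftrightarrow>
     \<mu> > 0 \<and> \<eta> > 0 \<and>
     (\<forall>\<theta>\<^sub>s\<in>minimizers f. \<forall>\<theta>. norm (grad f \<theta>) \<le> \<eta> \<longrightarrow>
        f \<theta> - f \<theta>\<^sub>s \<ge> \<mu> / 2 * (infdist \<theta> (minimizers f))\<^sup>2)"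

text \<open>The probability space \<open>\<Omega>\<close> carries the randomness of a single oracle call.\<close>

definition overestimation_oracle ::
    "(real ^ 'd \<Rightarrow> real) \<Rightarrow> 'w measure \<Rightarrow> (real ^ 'd \<Rightarrow> 'w \<Rightarrow> real ^ 'd ^ 'd) \<Rightarrow> bool" where
  "overestimation_oracle f \<Omega> B \<longleftrightarrow>
     prob_space \<Omega> \<and> (\<forall>\<theta>. AE \<omega> in \<Omega>. B \<theta> \<omega> \<succeq> hess f \<theta>)"

text \<open>The error is a supremum in \<open>[0,\<infinity>]\<close>, so that an unbounded error is \<open>\<infinity>\<close>
  rather than an unspecified real number.\<close>

definition oracle_error ::
    "(real ^ 'd \<Rightarrow> real) \<Rightarrow> real ^ 'd \<Rightarrow> 'w measure \<Rightarrow>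
     (real ^ 'd \<Rightarrow> 'w \<Rightarrow> real ^ 'd ^ 'd) \<Rightarrow> ennreal" where
  "oracle_error f \<theta>\<^sub>0 \<Omega> B =
     (SUP \<omega>\<in>space \<Omega>. SUP \<theta>\<in>sublevel f \<theta>\<^sub>0. ennreal (spectral_norm (B \<theta> \<omega> - hess f \<theta>)))"

definition ron_step ::
    "(real ^ 'd \<Rightarrow> real) \<Rightarrow> real \<Rightarrow> real ^ 'd ^ 'd \<Rightarrow> real ^ 'd \<Rightarrow> real ^ 'd" where
  "ron_step f L\<^sub>H B\<^sub>n \<theta> =
     (if grad f \<theta> = 0 then \<theta>
      else \<theta> - matrix_inv (B\<^sub>n + mat (sqrt (L\<^sub>H * norm (grad f \<theta>)))) *v grad f \<theta>)"

text \<open>The process lives on a probability space \<open>M\<close>: \<open>\<xi> n\<close> is the randomness used by the oracle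
  call of step \<open>n\<close>, with the law of \<open>\<Omega>\<close>. No independence of the calls is imposed.
  The matrix returned at step \<open>n\<close> is required to overestimate the Hessian at the random point
  \<open>\<theta> n\<close>; for dependent calls this does not follow from the oracle property at each fixed point.\<close>

definition ron_iteration ::
    "(real ^ 'd \<Rightarrow> real) \<Rightarrow> real \<Rightarrow> 'w measure \<Rightarrow> (real ^ 'd \<Rightarrow> 'w \<Rightarrow> real ^ 'd ^ 'd) \<Rightarrow>
     'p measure \<Rightarrow> (nat \<Rightarrow> 'p \<Rightarrow> 'w) \<Rightarrow> real ^ 'd \<Rightarrow> (nat \<Rightarrow> 'p \<Rightarrow> real ^ 'd) \<Rightarrow> bool" where
  "ron_iteration f L\<^sub>H \<Omega> B M \<xi> \<theta>\<^sub>0 \<theta> \<longleftrightarrow>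
     prob_space M \<and>
     (\<forall>n. \<xi> n \<in> measurable M \<Omega> \<and> distr M \<Omega> (\<xi> n) = \<Omega>) \<and>
     (AE x in M. \<theta> 0 x = \<theta>\<^sub>0 \<and>
        (\<forall>n. B (\<theta> n x) (\<xi> n x) \<succeq> hess f (\<theta> n x) \<and>
             \<theta> (Suc n) x = ron_step f L\<^sub>H (B (\<theta> n x) (\<xi> n x)) (\<theta> n x)))"

definition hitting_time ::
    "(real ^ 'd \<Rightarrow> real) \<Rightarrow> real \<Rightarrow> real \<Rightarrow> real \<Rightarrow> (nat \<Rightarrow> real ^ 'd) \<Rightarrow> real \<Rightarrow> enat" where
  "hitting_time f L\<^sub>H \<mu> \<eta> \<theta> \<gamma> =
     Inf {enat n | n. norm (grad f (\<theta> n)) < min ((\<gamma> * \<mu>)\<^sup>2 / L\<^sub>H) \<eta>}"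

definition gamma1 :: "real \<Rightarrow> real \<Rightarrow> real" where
  "gamma1 \<mu> \<epsilon> = min 0.2 (20 / 33 * (\<mu> / (1.2 * \<mu> + \<epsilon>)))"

definition converges_superlinearly_to_0 :: "(nat \<Rightarrow> real) \<Rightarrow> bool" where
  "converges_superlinearly_to_0 g \<longleftrightarrow>
     (\<forall>n. 0 \<le> g n) \<and> g \<longlonglongrightarrow> 0 \<and> (\<exists>\<rho>. \<rho> \<longlonglongrightarrow> 0 \<and> (\<forall>n. g (Suc n) \<le> \<rho> n * g n))"

end

theory Submission
  imports Defs
begin

text \<open>
  Vanishing oracle error forces the oracle to return the exact Hessian at every point of the
  sublevel set \<open>\<L>\<close> of the starting point, so almost every path is a run of Newton's method with
  regularisation \<open>\<lambda> = sqrt (K G)\<close>, where \<open>G\<close> is the current gradient norm and \<open>K\<close> the Lipschitz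
  constant of the Hessian on \<open>\<L>\<close>. Everything rests on the following consequence of this choice
  of \<open>\<lambda>\<close>. Since the Hessian is positive semidefinite, a step \<open>s\<close> has length at most
  \<open>G / \<lambda> = \<lambda> / K\<close>, that is, \<open>K |s| \<le> \<lambda>\<close>: the Taylor remainders along \<open>s\<close>, which have sizes
  \<open>K |s|\<^sup>2 / 2\<close> for the gradient and \<open>K |s|\<^sup>3 / 6\<close> for the function, are dominated by the
  regularisation terms \<open>\<lambda> |s|\<close> and \<open>\<lambda> |s|\<^sup>2\<close>.

  Globally, this makes the value drop by at least \<open>5/6 \<lambda> |s|\<^sup>2\<close>
  (\<open>descent_along_direction\<close>), so the iterates never leave \<open>\<L>\<close>
  (\<open>step_stays_in_sublevel\<close>), and it bounds the next gradient by \<open>3/2 \<lambda> |s|\<close>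
  (\<open>grad_after_step\<close>). Gradients that stay away from zero would therefore cost a fixed decrease
  at every step; as \<open>f\<close> is bounded below, some gradient falls below any given threshold
  (\<open>ex_small_grad\<close>).

  Locally, the rate follows from \<open>3/2 \<lambda> |s|\<close> once \<open>|s|\<close> is at most a suitable multiple of \<open>G / \<mu>\<close>.
  The Hessian may be singular, so this cannot come from the inverse alone. Instead \<open>s\<close> is compared
  with the displacement \<open>d\<close> to the nearest minimizer: \<open>|s|\<close> exceeds \<open>|d|\<close> by at most the Taylor
  error \<open>K |d|\<^sup>2 / (2 \<lambda>)\<close> (\<open>direction_le_distance\<close>), and quadratic growth bounds \<open>|d|\<close>.
  Convexity alone would give \<open>|d| \<le> 2 G / \<mu>\<close>, which is too weak for the stated constant;
  replacing the tangent estimate of the value gap by the trapezoidal rule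
  (\<open>value_gap_trapezoid\<close>) almost halves this bound and yields \<open>|s| \<le> 9/7 G / \<mu>\<close>, hence the constant
  \<open>3/2 * 9/7 = 27/14 \<le> 25/12\<close>. Below the threshold \<open>\<lambda> \<le> \<mu> / 5\<close>, so the gradient then also shrinks
  by the factor \<open>5/12\<close>, the threshold is never left again, and the ratio of successive gradient
  norms is \<open>O(\<lambda>)\<close>, which tends to zero.
\<close>

section \<open>Gradient and Hessian as derivatives\<close>

lemma has_derivative_grad:
  fixes f :: "real ^ 'd \<Rightarrow> real"
  assumes "f differentiable (at x)"
  shows "(f has_derivative (\<lambda>h. grad f x \<bullet> h)) (at x)"
proof -
  let ?D = "frechet_derivative f (at x)"
  have D: "(f has_derivative ?D) (at x)"
    using assms frechet_derivative_works by blast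
  have lin: "linear ?D"
    using D has_derivative_linear by blast
  have "?D h = grad f x \<bullet> h" for h
  proof -
    have "?D h = ?D (\<Sum>i\<in>UNIV. h $ i *\<^sub>R axis i 1)"
      by (simp add: basis_expansion flip: scalar_mult_eq_scaleR)
    also have "\<dots> = (\<Sum>i\<in>UNIV. h $ i *\<^sub>R ?D (axis i 1))"
      by (simp add: linear_sum[OF lin] linear_cmul[OF lin])
    also have "\<dots> = grad f x \<bullet> h"
      by (simp add: grad_def inner_vec_def mult.commute)
    finally show ?thesis .
  qed
  then show ?thesis
    using D by (metis (no_types, lifting) ext)
qed

lemma has_derivative_hess:
  fixes f :: "real ^ 'd \<Rightarrow> real"
  assumes "grad f differentiable (at x)"
  shows "(grad f has_derivative (\<lambda>h. hess f x *v h)) (at x)"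
  using assms unfolding hess_def by (simp add: jacobian_works)

lemma DERIV_along_line:
  fixes f :: "real ^ 'd \<Rightarrow> real"
  assumes "f differentiable (at (x + t *\<^sub>R s))"
  shows "((\<lambda>t. f (x + t *\<^sub>R s)) has_real_derivative (grad f (x + t *\<^sub>R s) \<bullet> s)) (at t)"
proof -
  have "((\<lambda>t. x + t *\<^sub>R s) has_derivative (\<lambda>h. h *\<^sub>R s)) (at t)"
    by (auto intro!: derivative_eq_intros)
  from has_derivative_compose[OF this has_derivative_grad[OF assms]]
  show ?thesis
    by (simp add: has_field_derivative_def mult.commute fun_eq_iff
        mult_commute_abs)
qed

lemma DERIV_grad_along_line:
  fixes f :: "real ^ 'd \<Rightarrow> real"
  assumes "grad f differentiable (at (x + t *\<^sub>R s))"
  shows "((\<lambda>t. u \<bullet> grad f (x + t *\<^sub>R s)) has_real_derivative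
           (u \<bullet> (hess f (x + t *\<^sub>R s) *v s))) (at t)"
proof -
  have "((\<lambda>t. x + t *\<^sub>R s) has_derivative (\<lambda>h. h *\<^sub>R s)) (at t)"
    by (auto intro!: derivative_eq_intros)
  from has_derivative_compose[OF this has_derivative_hess[OF assms]]
  have "((\<lambda>t. u \<bullet> grad f (x + t *\<^sub>R s)) has_derivative
           (\<lambda>h. u \<bullet> (hess f (x + t *\<^sub>R s) *v (h *\<^sub>R s)))) (at t)"
    by (rule has_derivative_inner_right)
  then show ?thesis
    by (simp add: has_field_derivative_def matrix_vector_mult_scaleR mult_commute_abs)
qed

lemma convex_above_tangent:
  fixes f :: "real ^ 'd \<Rightarrow> real"
  assumes "convex_on UNIV f" "f differentiable (at x)"
  shows "f y \<ge> f x + grad f x \<bullet> (y - x)"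
proof -
  let ?\<phi> = "\<lambda>t. f (x + t *\<^sub>R (y - x))"
  have conv: "convex_on UNIV ?\<phi>"
  proof (rule convex_onI)
    fix t u v :: real assume t: "0 < t" "t < 1"
    have "x + ((1 - t) *\<^sub>R u + t *\<^sub>R v) *\<^sub>R (y - x)
        = (1 - t) *\<^sub>R (x + u *\<^sub>R (y - x)) + t *\<^sub>R (x + v *\<^sub>R (y - x))"
      by (simp add: algebra_simps)
    then show "?\<phi> ((1 - t) *\<^sub>R u + t *\<^sub>R v) \<le> (1 - t) * ?\<phi> u + t * ?\<phi> v"
      using convex_onD[OF assms(1), of t "x + u *\<^sub>R (y - x)" "x + v *\<^sub>R (y - x)"] t by simp
  qed auto
  have "(?\<phi> has_real_derivative (grad f x \<bullet> (y - x))) (at 0)"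
    using DERIV_along_line[of f x 0 "y - x"] assms(2) by simp
  then have "?\<phi> 1 - ?\<phi> 0 \<ge> (grad f x \<bullet> (y - x)) * (1 - 0)"
    by (intro convex_on_imp_above_tangent[OF conv]) auto
  then show ?thesis by simp
qed

lemma convex_hess_nonneg:
  fixes f :: "real ^ 'd \<Rightarrow> real"
  assumes conv: "convex_on UNIV f" and df: "\<And>x. f differentiable (at x)"
    and dg: "grad f differentiable (at x)"
  shows "0 \<le> v \<bullet> (hess f x *v v)"
proof (rule ccontr)
  assume neg: "\<not> ?thesis"
  have "((\<lambda>t. v \<bullet> grad f (x + t *\<^sub>R v)) has_real_derivative (v \<bullet> (hess f x *v v))) (at 0)"
    using DERIV_grad_along_line[of f x 0 v v] dg by simp
  from DERIV_neg_dec_right[OF this] neg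
  have "\<exists>d>0. \<forall>h>0. h < d \<longrightarrow> v \<bullet> grad f (x + h *\<^sub>R v) < v \<bullet> grad f x"
    by simp
  then obtain d where d: "d > 0" "\<And>h. 0 < h \<Longrightarrow> h < d \<Longrightarrow>
      v \<bullet> grad f (x + h *\<^sub>R v) < v \<bullet> grad f x"
    by blast
  define h where "h = d / 2"
  have h: "0 < h" "v \<bullet> grad f (x + h *\<^sub>R v) < v \<bullet> grad f x"
    using d by (auto simp: h_def)
  \<comment> \<open>The two tangent inequalities between the end points make the gradient monotone.\<close>
  have "f (x + h *\<^sub>R v) \<ge> f x + h * (v \<bullet> grad f x)"
    using convex_above_tangent[OF conv df, of x "x + h *\<^sub>R v"] by (simp add: inner_commute)
  moreover have "f x \<ge> f (x + h *\<^sub>R v) - h * (v \<bullet> grad f (x + h *\<^sub>R v))"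
    using convex_above_tangent[OF conv df, of "x + h *\<^sub>R v" x] by (simp add: inner_commute)
  ultimately have "h * (v \<bullet> grad f x) \<le> h * (v \<bullet> grad f (x + h *\<^sub>R v))"
    by linarith
  then show False
    using h by simp
qed

lemma norm_mult_le_spectral_norm:
  fixes A :: "real ^ 'd ^ 'd"
  shows "norm (A *v v) \<le> spectral_norm A * norm v"
  unfolding spectral_norm_def by (rule onorm) (rule matrix_vector_mul_bounded_linear)

lemma spectral_norm_le_0_iff:
  fixes A :: "real ^ 'd ^ 'd"
  shows "spectral_norm A \<le> 0 \<longleftrightarrow> A = 0"
proof -
  have bl: "bounded_linear ((*v) A)"
    by (rule matrix_vector_mul_bounded_linear)
  have "spectral_norm A \<le> 0 \<longleftrightarrow> spectral_norm A = 0"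
    using onorm_pos_le[OF bl] by (simp add: spectral_norm_def order_antisym_conv)
  also have "\<dots> \<longleftrightarrow> (\<forall>v. A *v v = 0)"
    using onorm_eq_0[OF bl] by (simp add: spectral_norm_def)
  also have "\<dots> \<longleftrightarrow> A = 0"
    by (metis matrix_eq matrix_vector_mult_0)
  finally show ?thesis .
qed

section \<open>Taylor estimates for a Lipschitz Hessian\<close>

text \<open>The Hessian is controlled on \<open>C\<close> only, so each estimate below asks for both end points in \<open>C\<close>;
  convexity then keeps the segment between them, along which derivatives are compared, inside.\<close>

locale lipschitz_hessian =
  fixes f :: "real ^ 'd \<Rightarrow> real" and C :: "(real ^ 'd) set" and K :: real
  assumes diff_f: "\<And>x. f differentiable (at x)"
    and diff_grad: "\<And>x. grad f differentiable (at x)"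
    and convex_C: "convex C"
    and K_pos: "0 < K"
    and hess_lipschitz: "\<And>x y. x \<in> C \<Longrightarrow> y \<in> C \<Longrightarrow>
      spectral_norm (hess f x - hess f y) \<le> K * norm (x - y)"
begin

lemma line_in_C:
  assumes "x \<in> C" "x + s \<in> C" "0 \<le> t" "t \<le> 1"
  shows "x + t *\<^sub>R s \<in> C"
proof -
  have "(1 - t) *\<^sub>R x + t *\<^sub>R (x + s) \<in> C"
    using assms convex_C by (intro convexD) auto
  then show ?thesis by (simp add: algebra_simps)
qed

text \<open>The scalar function to differentiate is the component of the remainder in its own direction
  \<open>w\<close>, minus the claimed bound; the Lipschitz condition makes its derivative nonpositive. This
  avoids integrating a vector-valued function.\<close>

lemma grad_taylor:
  assumes x: "x \<in> C" "x + s \<in> C"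
  shows "norm (grad f (x + s) - grad f x - hess f x *v s) \<le> K / 2 * (norm s)\<^sup>2"
proof -
  define w where "w = grad f (x + s) - grad f x - hess f x *v s"
  let ?\<psi> = "\<lambda>t. w \<bullet> grad f (x + t *\<^sub>R s) - t * (w \<bullet> (hess f x *v s))
                 - K / 2 * t\<^sup>2 * (norm s)\<^sup>2 * norm w"
  have "?\<psi> 1 \<le> ?\<psi> 0"
  proof (rule DERIV_nonpos_imp_nonincreasing[of 0 1 ?\<psi>])
    fix t :: real assume t: "0 \<le> t" "t \<le> 1"
    let ?D = "w \<bullet> (hess f (x + t *\<^sub>R s) *v s) - w \<bullet> (hess f x *v s)
                 - K * t * (norm s)\<^sup>2 * norm w"
    have "(?\<psi> has_real_derivative ?D) (at t)"
      by (rule derivative_eq_intros DERIV_grad_along_line diff_grad refl | simp)+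
    moreover have "?D \<le> 0"
    proof -
      have "w \<bullet> (hess f (x + t *\<^sub>R s) *v s) - w \<bullet> (hess f x *v s)
          = w \<bullet> ((hess f (x + t *\<^sub>R s) - hess f x) *v s)"
        by (simp add: inner_diff_right matrix_vector_mult_diff_rdistrib)
      also have "\<dots> \<le> norm w * norm ((hess f (x + t *\<^sub>R s) - hess f x) *v s)"
        by (rule norm_cauchy_schwarz)
      also have "\<dots> \<le> norm w * (spectral_norm (hess f (x + t *\<^sub>R s) - hess f x) * norm s)"
        by (intro mult_left_mono norm_mult_le_spectral_norm) auto
      also have "\<dots> \<le> norm w * (K * norm ((x + t *\<^sub>R s) - x) * norm s)"
        by (intro mult_left_mono mult_right_mono hess_lipschitz line_in_C x t) auto
      also have "\<dots> = K * t * (norm s)\<^sup>2 * norm w"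
        using t by (simp add: power2_eq_square)
      finally show ?thesis by simp
    qed
    ultimately show "\<exists>y. (?\<psi> has_real_derivative y) (at t) \<and> y \<le> 0" by blast
  qed simp
  then have "w \<bullet> w \<le> K / 2 * (norm s)\<^sup>2 * norm w"
    by (simp add: w_def inner_diff_right)
  then have "norm w * norm w \<le> K / 2 * (norm s)\<^sup>2 * norm w"
    by (simp add: power2_norm_eq_inner flip: power2_eq_square)
  then show ?thesis
    using K_pos unfolding w_def[symmetric] by (cases "w = 0") auto
qed

text \<open>Integrates \<open>grad_taylor\<close> along the segment; the sign \<open>\<sigma>\<close> gives the upper and the lower
  bound at once.\<close>

lemma taylor_signed:
  assumes x: "x \<in> C" "x + s \<in> C" and \<sigma>: "\<bar>\<sigma>\<bar> = 1"
  shows "\<sigma> * (f (x + s) - f x - grad f x \<bullet> s - (s \<bullet> (hess f x *v s)) / 2) \<le> K / 6 * (norm s) ^ 3"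
proof -
  let ?\<chi> = "\<lambda>t. \<sigma> * (f (x + t *\<^sub>R s) - t * (grad f x \<bullet> s) - t\<^sup>2 / 2 * (s \<bullet> (hess f x *v s)))
                 - K / 6 * t ^ 3 * (norm s) ^ 3"
  have "?\<chi> 1 \<le> ?\<chi> 0"
  proof (rule DERIV_nonpos_imp_nonincreasing[of 0 1 ?\<chi>])
    fix t :: real assume t: "0 \<le> t" "t \<le> 1"
    let ?D = "\<sigma> * (grad f (x + t *\<^sub>R s) \<bullet> s - grad f x \<bullet> s - t * (s \<bullet> (hess f x *v s)))
                 - K / 2 * t\<^sup>2 * (norm s) ^ 3"
    have "(?\<chi> has_real_derivative ?D) (at t)"
      by (rule derivative_eq_intros DERIV_along_line diff_f refl | simp)+
    moreover have "?D \<le> 0"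
    proof -
      let ?w = "grad f (x + t *\<^sub>R s) - grad f x - hess f x *v (t *\<^sub>R s)"
      have "\<sigma> * (grad f (x + t *\<^sub>R s) \<bullet> s - grad f x \<bullet> s - t * (s \<bullet> (hess f x *v s)))
          = \<sigma> * (?w \<bullet> s)"
        by (simp add: inner_diff_left matrix_vector_mult_scaleR inner_commute[of s])
      also have "\<dots> \<le> \<bar>\<sigma> * (?w \<bullet> s)\<bar>" by (rule abs_ge_self)
      also have "\<dots> \<le> norm ?w * norm s"
        by (simp add: abs_mult \<sigma> Cauchy_Schwarz_ineq2)
      also have "\<dots> \<le> K / 2 * (norm (t *\<^sub>R s))\<^sup>2 * norm s"
        by (intro mult_right_mono grad_taylor line_in_C x t) auto
      also have "\<dots> = K / 2 * t\<^sup>2 * (norm s) ^ 3"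
        by (simp add: power_mult_distrib power2_eq_square power3_eq_cube)
      finally show ?thesis by simp
    qed
    ultimately show "\<exists>y. (?\<chi> has_real_derivative y) (at t) \<and> y \<le> 0" by blast
  qed simp
  then show ?thesis by (simp add: algebra_simps)
qed

lemma taylor_upper:
  assumes "x \<in> C" "x + s \<in> C"
  shows "f (x + s) \<le> f x + grad f x \<bullet> s + (s \<bullet> (hess f x *v s)) / 2 + K / 6 * (norm s) ^ 3"
  using taylor_signed[OF assms, of 1] by simp

lemma taylor_lower:
  assumes "x \<in> C" "x + s \<in> C"
  shows "f (x + s) \<ge> f x + grad f x \<bullet> s + (s \<bullet> (hess f x *v s)) / 2 - K / 6 * (norm s) ^ 3"
  using taylor_signed[OF assms, of "- 1"] by simp

end

section \<open>Regularised linear systems\<close>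

lemma mat_mult_vec: "mat c *v (v :: real ^ 'd) = c *\<^sub>R v"
  by (simp add: vec_eq_iff matrix_vector_mult_def mat_def if_distrib[of "\<lambda>a. a * _"] cong: if_cong)

context
  fixes H :: "real ^ 'd ^ 'd" and \<tau> :: real
  assumes H_nonneg: "\<And>v. 0 \<le> v \<bullet> (H *v v)" and \<tau>_pos: "0 < \<tau>"
begin

lemma regularised_mult: "(H + mat \<tau>) *v v = H *v v + \<tau> *\<^sub>R v"
  by (simp add: matrix_vector_mult_add_rdistrib mat_mult_vec)

lemma norm_regularised_solution:
  assumes "(H + mat \<tau>) *v s = g"
  shows "\<tau> * norm s \<le> norm g"
proof -
  have "\<tau> * (norm s * norm s) \<le> s \<bullet> (H *v s) + \<tau> * (s \<bullet> s)"
    using H_nonneg[of s] by (simp add: power2_norm_eq_inner flip: power2_eq_square)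
  also have "\<dots> = s \<bullet> g"
    using assms by (auto simp: regularised_mult inner_add_right)
  also have "\<dots> \<le> norm s * norm g"
    by (rule norm_cauchy_schwarz)
  finally have "norm s * (\<tau> * norm s) \<le> norm s * norm g"
    by (simp add: algebra_simps)
  then show ?thesis
    by (cases "s = 0") auto
qed

text \<open>In terms of \<open>w = s - d\<close> the hypothesis reads \<open>H w = - \<tau> s\<close>, so that \<open>w \<bullet> s \<le> 0\<close>: the vector
  \<open>s\<close> lies in the ball that has the segment from \<open>0\<close> to \<open>d\<close> as a diameter.\<close>

lemma regularised_contraction:
  assumes "(H + mat \<tau>) *v s = H *v d"
  shows "norm s \<le> norm d"
proof -
  have "\<tau> *\<^sub>R s = - (H *v (s - d))"
    using assms unfolding regularised_mult matrix_vector_mult_diff_distrib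
    by (simp add: algebra_simps)
  then have "\<tau> * ((s - d) \<bullet> s) = - ((s - d) \<bullet> (H *v (s - d)))"
    by (metis inner_minus_right inner_scaleR_right)
  then have "\<tau> * ((s - d) \<bullet> s) \<le> 0"
    using H_nonneg[of "s - d"] by simp
  then have "s \<bullet> s \<le> d \<bullet> s"
    using \<tau>_pos by (simp add: mult_le_0_iff inner_diff_left)
  also have "\<dots> \<le> norm d * norm s"
    by (rule norm_cauchy_schwarz)
  finally have "norm s * norm s \<le> norm d * norm s"
    by (simp add: power2_norm_eq_inner flip: power2_eq_square)
  then show ?thesis
    by (cases "s = 0") auto
qed

lemma regularised_solve: "(H + mat \<tau>) *v (matrix_inv (H + mat \<tau>) *v g) = g"
proof -
  have "v = 0" if "(H + mat \<tau>) *v v = 0" for v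
    using norm_regularised_solution[OF that] \<tau>_pos by (simp add: mult_le_0_iff)
  then have "invertible (H + mat \<tau>)"
    using matrix_left_invertible_ker invertible_left_inverse by blast
  then have "(H + mat \<tau>) ** matrix_inv (H + mat \<tau>) = mat 1"
    unfolding invertible_def matrix_inv_def by (rule someI2_ex) simp
  then show ?thesis
    by (simp add: matrix_vector_mul_assoc)
qed

end

section \<open>One step of the regularised Newton iteration\<close>

locale regularised_newton =
  lipschitz_hessian f "sublevel f x\<^sub>0" K
  for f :: "real ^ 'd \<Rightarrow> real" and x\<^sub>0 :: "real ^ 'd" and K :: real +
  assumes convex_f: "convex_on UNIV f"
begin

definition reg :: "real ^ 'd \<Rightarrow> real" where
  "reg x = sqrt (K * norm (grad f x))"

definition direction :: "real ^ 'd \<Rightarrow> real ^ 'd" where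
  "direction x = - (matrix_inv (hess f x + mat (reg x)) *v grad f x)"

lemma ron_step_eq: "grad f x \<noteq> 0 \<Longrightarrow> ron_step f K (hess f x) x = x + direction x"
  by (simp add: ron_step_def direction_def reg_def)

lemma hess_nonneg: "0 \<le> v \<bullet> (hess f x *v v)"
  by (rule convex_hess_nonneg[OF convex_f diff_f diff_grad])

lemma reg_nonneg: "0 \<le> reg x"
  using K_pos by (simp add: reg_def)

lemma reg_squared: "(reg x)\<^sup>2 = K * norm (grad f x)"
  using K_pos by (simp add: reg_def)

lemma reg_pos: "grad f x \<noteq> 0 \<Longrightarrow> 0 < reg x"
  using K_pos by (simp add: reg_def)

lemma regularised_direction:
  assumes "grad f x \<noteq> 0"
  shows "(hess f x + mat (reg x)) *v direction x = - grad f x"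
  using regularised_solve[OF hess_nonneg reg_pos[OF assms], where g = "grad f x"]
  by (simp add: direction_def linear_neg[OF matrix_vector_mul_linear])

lemma newton_equation:
  assumes "grad f x \<noteq> 0"
  shows "grad f x = - (hess f x *v direction x) - reg x *\<^sub>R direction x"
proof -
  have "hess f x *v direction x + reg x *\<^sub>R direction x = - grad f x"
    using regularised_direction[OF assms]
    unfolding regularised_mult[OF hess_nonneg reg_pos[OF assms]] .
  then have "- (hess f x *v direction x + reg x *\<^sub>R direction x) = grad f x"
    by simp
  then show ?thesis
    by (simp only: minus_add_distrib add_uminus_conv_diff)
qed

text \<open>The reason for the square root in \<open>reg\<close>: the direction has length at most
  \<open>G / reg x\<close>, and \<open>K G\<close> is the square of \<open>reg x\<close>.\<close>

lemma lipschitz_direction_le_reg: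
  assumes "grad f x \<noteq> 0"
  shows "K * norm (direction x) \<le> reg x"
proof -
  have "reg x * norm (direction x) \<le> norm (grad f x)"
    using norm_regularised_solution[OF hess_nonneg reg_pos[OF assms] regularised_direction[OF assms]]
    by simp
  then have "reg x * (K * norm (direction x)) \<le> reg x * reg x"
    using mult_left_mono[of "reg x * norm (direction x)" "norm (grad f x)" K] K_pos
    by (simp add: reg_squared mult.left_commute flip: power2_eq_square)
  then show ?thesis
    using reg_pos[OF assms] by simp
qed

text \<open>By the Newton equation the linear model of the new gradient is exactly \<open>- reg x\<close> times the
  direction; the Taylor error is at most half as large.\<close>

lemma grad_after_step:
  assumes g: "grad f x \<noteq> 0" and x: "x \<in> sublevel f x\<^sub>0" "x + direction x \<in> sublevel f x\<^sub>0"
  shows "norm (grad f (x + direction x)) \<le> 3 / 2 * reg x * norm (direction x)"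
proof -
  let ?s = "direction x"
  let ?w = "grad f (x + ?s) - grad f x - hess f x *v ?s"
  have "?w - reg x *\<^sub>R ?s = grad f (x + ?s)
      - (grad f x - (- (hess f x *v ?s) - reg x *\<^sub>R ?s))"
    by simp
  then have "grad f (x + ?s) = ?w - reg x *\<^sub>R ?s"
    using newton_equation[OF g] by (simp only: diff_self diff_zero)
  then have "norm (grad f (x + ?s)) \<le> norm ?w + reg x * norm ?s"
    using norm_triangle_ineq4[of ?w "reg x *\<^sub>R ?s"] reg_nonneg[of x] by (simp only: norm_scaleR abs_of_nonneg)
  also have "norm ?w \<le> (K * norm ?s) * norm ?s / 2"
    using grad_taylor[OF x] by (simp add: power2_eq_square)
  also have "\<dots> \<le> reg x * norm ?s / 2"
    by (intro divide_right_mono mult_right_mono lipschitz_direction_le_reg g) auto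
  finally show ?thesis by simp
qed

text \<open>The Newton equation turns the linear term into \<open>- t (q + p)\<close>, with \<open>q\<close> the curvature and \<open>p\<close>
  the regularisation along the direction. The quadratic term \<open>t\<^sup>2 q / 2\<close> is absorbed by \<open>q\<close> and the
  cubic remainder costs a sixth of \<open>p\<close>. Fractional steps \<open>t\<close> are allowed because the full step is
  not yet known to end in the sublevel set.\<close>

lemma descent_along_direction:
  assumes g: "grad f x \<noteq> 0" and t: "0 \<le> t" "t \<le> 1"
    and x: "x \<in> sublevel f x\<^sub>0" "x + t *\<^sub>R direction x \<in> sublevel f x\<^sub>0"
  shows "f (x + t *\<^sub>R direction x) \<le> f x - 5 / 6 * t * (reg x * (norm (direction x))\<^sup>2)"
proof -
  let ?s = "direction x"
  define q where "q = ?s \<bullet> (hess f x *v ?s)"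
  define p where "p = reg x * (norm ?s)\<^sup>2"
  have "grad f x \<bullet> ?s = ?s \<bullet> (- (hess f x *v ?s) - reg x *\<^sub>R ?s)"
    by (subst newton_equation[OF g]) (rule inner_commute)
  also have "\<dots> = - q - p"
    unfolding p_def q_def inner_diff_right inner_minus_right inner_scaleR_right
      power2_norm_eq_inner ..
  finally have gs: "grad f x \<bullet> ?s = - q - p" .
  have q: "0 \<le> q" unfolding q_def by (rule hess_nonneg)
  have "f (x + t *\<^sub>R ?s) \<le> f x + t * (- q - p) + t\<^sup>2 * q / 2 + K / 6 * t ^ 3 * norm ?s ^ 3"
    using taylor_upper[OF x] t
    by (simp add: gs matrix_vector_mult_scaleR power_mult_distrib
        power2_eq_square mult_ac flip: q_def)
  moreover have "t\<^sup>2 * q \<le> t * q"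
    using t q by (intro mult_right_mono) (auto simp: power2_eq_square mult_left_le)
  moreover have "K / 6 * t ^ 3 * norm ?s ^ 3 \<le> t * p / 6"
  proof -
    have "t ^ 3 \<le> t ^ 1"
      using t by (intro power_decreasing) auto
    moreover have "K * norm ?s ^ 3 \<le> p"
      using mult_right_mono[OF lipschitz_direction_le_reg[OF g], of "(norm ?s)\<^sup>2"]
      by (simp add: p_def power2_eq_square power3_eq_cube mult_ac)
    ultimately have "t ^ 3 * (K * norm ?s ^ 3) \<le> t * p"
      using t K_pos by (intro mult_mono) auto
    then show ?thesis by (simp add: mult_ac)
  qed
  moreover have "0 \<le> t * q"
    using t q by simp
  ultimately show ?thesis
    by (simp add: algebra_simps flip: p_def)
qed

lemma direction_nonzero: "grad f x \<noteq> 0 \<Longrightarrow> direction x \<noteq> 0"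
  using newton_equation[of x] by auto

text \<open>The Taylor estimates hold only inside the sublevel set, so they cannot be applied to the full
  step directly. If that step ended outside, the value, which decreases at first, would have to
  return to \<open>f x\<^sub>0\<close> at some intermediate point. This point is still in the sublevel set, where the
  descent estimate forbids such a value.\<close>

lemma step_stays_in_sublevel:
  assumes g: "grad f x \<noteq> 0" and x: "x \<in> sublevel f x\<^sub>0"
  shows "x + direction x \<in> sublevel f x\<^sub>0"
proof (rule ccontr)
  let ?s = "direction x"
  let ?\<phi> = "\<lambda>t. f (x + t *\<^sub>R ?s)"
  assume "\<not> ?thesis"
  then have above: "f x\<^sub>0 < ?\<phi> 1" by (simp add: sublevel_def)
  have decrease: "0 < reg x * (norm ?s)\<^sup>2"
    using reg_pos[OF g] direction_nonzero[OF g] by simp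
  have "grad f x \<bullet> ?s = ?s \<bullet> (- (hess f x *v ?s) - reg x *\<^sub>R ?s)"
    by (subst newton_equation[OF g]) (rule inner_commute)
  then have "grad f x \<bullet> ?s < 0"
    using hess_nonneg[of ?s x] decrease
    by (simp add: inner_diff_right power2_norm_eq_inner)
  moreover have "(?\<phi> has_real_derivative (grad f x \<bullet> ?s)) (at 0)"
    using DERIV_along_line[of f x 0 ?s] diff_f by simp
  ultimately have "\<exists>d>0. \<forall>h>0. h < d \<longrightarrow> ?\<phi> (0 + h) < ?\<phi> 0"
    by (intro DERIV_neg_dec_right)
  then obtain d where d: "d > 0" "\<And>h. 0 < h \<Longrightarrow> h < d \<Longrightarrow> ?\<phi> h < f x"
    by auto
  define h where "h = min (d / 2) 1"
  have h: "0 < h" "h \<le> 1" "?\<phi> h < f x"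
    using d by (auto simp: h_def min_def)
  have le: "f x \<le> f x\<^sub>0"
    using x by (simp add: sublevel_def)
  have "isCont ?\<phi> t" for t
    using DERIV_isCont DERIV_along_line diff_f by blast
  then obtain T where T: "h \<le> T" "T \<le> 1" "?\<phi> T = f x\<^sub>0"
    using IVT[of ?\<phi> h "f x\<^sub>0" 1] h le above by fastforce
  then have "?\<phi> T \<le> f x - 5 / 6 * T * (reg x * (norm ?s)\<^sup>2)"
    using h by (intro descent_along_direction g x) (auto simp: sublevel_def)
  moreover have "0 < 5 / 6 * T * (reg x * (norm ?s)\<^sup>2)"
    using T h decrease by (intro mult_pos_pos[of "5 / 6 * T"]) auto
  ultimately show False
    using T le by linarith
qed

lemma descent_by_next_grad:
  assumes g: "grad f x \<noteq> 0" and x: "x \<in> sublevel f x\<^sub>0"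
  shows "(norm (grad f (x + direction x)))\<^sup>2 \<le> 27 / 10 * reg x * (f x - f (x + direction x))"
proof -
  let ?s = "direction x"
  have "(norm (grad f (x + ?s)))\<^sup>2 \<le> (3 / 2 * reg x * norm ?s)\<^sup>2"
    by (intro power_mono grad_after_step step_stays_in_sublevel g x) auto
  also have "\<dots> = 27 / 10 * reg x * (5 / 6 * 1 * (reg x * (norm ?s)\<^sup>2))"
    by (simp add: power_mult_distrib power2_eq_square)
  also have "\<dots> \<le> 27 / 10 * reg x * (f x - f (x + ?s))"
  proof (rule mult_left_mono)
    show "5 / 6 * 1 * (reg x * (norm ?s)\<^sup>2) \<le> f x - f (x + ?s)"
      using descent_along_direction[OF g, of 1] step_stays_in_sublevel[OF g x] x by simp
  qed (simp add: reg_nonneg)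
  finally show ?thesis .
qed

section \<open>Steps near the set of minimizers\<close>

lemma grad_minimizer:
  assumes "m \<in> minimizers f"
  shows "grad f m = 0"
proof -
  have "f m \<le> f y" for y
    using assms by (simp add: minimizers_def is_arg_min_linorder)
  then have "(\<lambda>h. grad f m \<bullet> h) = (\<lambda>h. 0)"
    by (intro differential_zero_maxmin[OF _ _ has_derivative_grad[OF diff_f], of m UNIV]) auto
  then have "grad f m \<bullet> grad f m = 0"
    by (rule fun_cong)
  then show ?thesis by simp
qed

text \<open>Write \<open>- grad f x = H d - e\<close> with the Taylor error \<open>e\<close> towards \<open>m\<close>. Solving for the two
  parts separately, the first gives a vector no longer than \<open>d\<close>, whatever the conditioning of
  \<open>H\<close>, and the second one of length at most \<open>norm e / reg x\<close>.\<close>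

lemma direction_le_distance:
  assumes g: "grad f x \<noteq> 0" and m: "grad f m = 0"
    and x: "x \<in> sublevel f x\<^sub>0" "m \<in> sublevel f x\<^sub>0"
  shows "norm (direction x) \<le> norm (m - x) + K * (norm (m - x))\<^sup>2 / (2 * reg x)"
proof -
  define d where "d = m - x"
  define e where "e = grad f x + hess f x *v d"
  let ?A = "hess f x + mat (reg x)"
  define u where "u = matrix_inv ?A *v (hess f x *v d)"
  have Au: "?A *v u = hess f x *v d"
    unfolding u_def by (rule regularised_solve[OF hess_nonneg reg_pos[OF g]])
  have "norm u \<le> norm d"
    by (rule regularised_contraction[OF hess_nonneg reg_pos[OF g] Au])
  moreover have "reg x * norm (direction x - u) \<le> K / 2 * (norm d)\<^sup>2"
  proof -
    have "?A *v (direction x - u) = - e"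
      by (simp add: matrix_vector_mult_diff_distrib regularised_direction[OF g] Au e_def)
    then have "reg x * norm (direction x - u) \<le> norm (- e)"
      by (rule norm_regularised_solution[OF hess_nonneg reg_pos[OF g]])
    moreover have "grad f (x + d) - grad f x - hess f x *v d = - e"
      by (simp add: d_def m e_def)
    then have "norm (- e) \<le> K / 2 * (norm d)\<^sup>2"
      using grad_taylor[of x d] x by (simp add: d_def)
    ultimately show ?thesis by linarith
  qed
  then have "norm (direction x - u) \<le> K * (norm d)\<^sup>2 / (2 * reg x)"
    using reg_pos[OF g] by (simp add: field_simps)
  ultimately show ?thesis
    using norm_triangle_sub[of "direction x" u] by (simp flip: d_def)
qed

text \<open>The trapezoidal rule for \<open>f\<close> along the segment, whose derivative vanishes at \<open>m\<close>: only half
  of the tangent bound is left, up to the cubic error \<open>1/6 + 1/4 = 5/12\<close>.\<close>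

lemma value_gap_trapezoid:
  assumes m: "grad f m = 0" and x: "x \<in> sublevel f x\<^sub>0" "m \<in> sublevel f x\<^sub>0"
  shows "f x - f m \<le> norm (grad f x) * norm (m - x) / 2 + 5 / 12 * K * norm (m - x) ^ 3"
proof -
  define d where "d = m - x"
  define e where "e = grad f x + hess f x *v d"
  have d: "x + d = m" by (simp add: d_def)
  have "grad f (x + d) - grad f x - hess f x *v d = - e"
    by (simp add: d m e_def)
  then have e: "norm e \<le> K / 2 * (norm d)\<^sup>2"
    using grad_taylor[of x d] x d by (metis norm_minus_cancel)
  have "f x - f m \<le> - (grad f x \<bullet> d) - (d \<bullet> (hess f x *v d)) / 2 + K / 6 * norm d ^ 3"
    using taylor_lower[of x d] x d by simp
  also have "\<dots> = - (grad f x \<bullet> d) / 2 - (d \<bullet> e) / 2 + K / 6 * norm d ^ 3"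
    by (simp add: e_def inner_add_right inner_commute field_simps)
  finally have "f x - f m \<le> - (grad f x \<bullet> d) / 2 - (d \<bullet> e) / 2 + K / 6 * norm d ^ 3" .
  moreover have "- (grad f x \<bullet> d) \<le> norm (grad f x) * norm d"
    using Cauchy_Schwarz_ineq2[of "grad f x" d] by linarith
  moreover have "- (d \<bullet> e) \<le> norm d * (K / 2 * (norm d)\<^sup>2)"
  proof -
    have "- (d \<bullet> e) \<le> norm d * norm e"
      using Cauchy_Schwarz_ineq2[of d e] by linarith
    also have "\<dots> \<le> norm d * (K / 2 * (norm d)\<^sup>2)"
      using e by (intro mult_left_mono) auto
    finally show ?thesis .
  qed
  then have "- (d \<bullet> e) \<le> K / 2 * norm d ^ 3"
    by (simp add: power2_eq_square power3_eq_cube algebra_simps)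
  ultimately show ?thesis
    unfolding d_def[symmetric] by linarith
qed

lemma value_gap_tangent:
  "f x - f m \<le> norm (grad f x) * norm (m - x)"
  using convex_above_tangent[OF convex_f diff_f, of x m]
    Cauchy_Schwarz_ineq2[of "grad f x" "m - x"] by linarith

text \<open>A bootstrap: the crude bound \<open>\<mu> \<delta> \<le> 2 G\<close> on the distance \<open>\<delta>\<close> shows that \<open>K \<delta>\<close> is small
  compared with \<open>reg x\<close> and \<open>\<mu>\<close>, which makes the cubic error of the trapezoidal rule harmless and
  improves the bound to \<open>\<mu> \<delta> \<le> 15/14 G\<close>. The final constant is \<open>6/5 * 15/14 = 9/7\<close>.\<close>

lemma direction_bound_near_minimizer:
  assumes g: "grad f x \<noteq> 0" and m: "grad f m = 0"
    and x: "x \<in> sublevel f x\<^sub>0" "m \<in> sublevel f x\<^sub>0"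
    and \<mu>: "0 < \<mu>" and growth: "\<mu> / 2 * (norm (m - x))\<^sup>2 \<le> f x - f m"
    and near: "5 * reg x \<le> \<mu>"
  shows "\<mu> * norm (direction x) \<le> 9 / 7 * norm (grad f x)"
proof -
  define \<delta> where "\<delta> = norm (m - x)"
  define G where "G = norm (grad f x)"
  have \<delta>0: "0 \<le> \<delta>" and r: "0 < reg x" and G0: "0 \<le> G"
    using reg_pos[OF g] by (auto simp: \<delta>_def G_def)
  have crude: "\<mu> * \<delta> \<le> 2 * G"
  proof -
    have "\<delta> * (\<mu> * \<delta>) \<le> \<delta> * (2 * G)"
      using growth value_gap_tangent[of x m]
      by (simp add: power2_eq_square algebra_simps flip: \<delta>_def G_def)
    then show ?thesis
      using \<delta>0 G0 by (cases "\<delta> = 0") auto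
  qed
  have K\<delta>: "K * \<delta> \<le> 2 / 5 * reg x"
  proof -
    have "\<mu> * (K * \<delta>) = K * (\<mu> * \<delta>)" by simp
    also have "\<dots> \<le> K * (2 * G)"
      using crude K_pos by (intro mult_left_mono) auto
    also have "\<dots> = 2 * reg x * reg x"
      using reg_squared[of x] by (simp add: G_def power2_eq_square)
    also have "\<dots> \<le> \<mu> * (2 / 5 * reg x)"
      using near r mult_right_mono[of "5 * reg x" \<mu> "reg x"] by (simp add: algebra_simps)
    finally show ?thesis
      using \<mu> by simp
  qed
  have sharp: "\<mu> * \<delta> \<le> 15 / 14 * G"
  proof -
    have "\<mu> / 2 * \<delta>\<^sup>2 \<le> G * \<delta> / 2 + 5 / 12 * K * \<delta> ^ 3"
      using growth value_gap_trapezoid[OF m x] by (simp flip: \<delta>_def G_def)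
    also have "\<dots> = \<delta> * (G / 2 + 5 / 12 * (K * \<delta>) * \<delta>)"
      by (simp add: power3_eq_cube algebra_simps)
    also have "\<dots> \<le> \<delta> * (G / 2 + 5 / 12 * (2 / 25 * \<mu>) * \<delta>)"
      using K\<delta> near \<delta>0 by (intro mult_left_mono add_left_mono mult_right_mono) auto
    finally have "\<delta> * (\<mu> * \<delta>) \<le> \<delta> * (15 / 14 * G)"
      by (simp add: power2_eq_square algebra_simps)
    then show ?thesis
      using \<delta>0 G0 by (cases "\<delta> = 0") auto
  qed
  have "norm (direction x) \<le> \<delta> + K * \<delta>\<^sup>2 / (2 * reg x)"
    using direction_le_distance[OF g m x] by (simp flip: \<delta>_def)
  also have "\<dots> \<le> 6 / 5 * \<delta>"
    using mult_right_mono[OF K\<delta> \<delta>0] r by (simp add: field_simps power2_eq_square)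
  finally have "\<mu> * norm (direction x) \<le> \<mu> * (6 / 5 * \<delta>)"
    using \<mu> by (intro mult_left_mono) auto
  also have "\<dots> \<le> 9 / 7 * G"
    using sharp by (simp add: mult.commute)
  finally show ?thesis by (simp add: G_def)
qed

section \<open>Global and local convergence\<close>

lemma continuous_on_f: "continuous_on S f"
  by (meson continuous_at_imp_continuous_on differentiable_imp_continuous_within diff_f)

lemma continuous_on_grad: "continuous_on S (grad f)"
  by (meson continuous_at_imp_continuous_on differentiable_imp_continuous_within diff_grad)

lemma minimizers_nonempty:
  assumes "compact (sublevel f x\<^sub>0)"
  shows "minimizers f \<noteq> {}"
proof -
  have "sublevel f x\<^sub>0 \<noteq> {}"
    by (auto simp: sublevel_def)
  then obtain m where m: "m \<in> sublevel f x\<^sub>0" "\<And>y. y \<in> sublevel f x\<^sub>0 \<Longrightarrow> f m \<le> f y"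
    using continuous_attains_inf[OF assms _ continuous_on_f] by blast
  have "f m \<le> f y" for y
  proof (cases "f y \<le> f x\<^sub>0")
    case True
    then show ?thesis using m(2) by (simp add: sublevel_def)
  next
    case False
    then show ?thesis using m(1) by (simp add: sublevel_def)
  qed
  then show ?thesis
    by (auto simp: minimizers_def is_arg_min_linorder)
qed

lemma minimizer_le: "m \<in> minimizers f \<Longrightarrow> f m \<le> f y"
  by (simp add: minimizers_def is_arg_min_linorder)

lemma closed_minimizers: "closed (minimizers f)"
proof -
  have "minimizers f = (\<Inter>y. {m. f m \<le> f y})"
    by (auto simp: minimizers_def is_arg_min_linorder)
  then show ?thesis
    by (auto intro!: closed_Collect_le continuous_on_f continuous_intros)
qed

text \<open>Keeping the factor \<open>reg x\<close>, which is a multiple of the square root of the gradient norm, serves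
  three purposes: with the second conclusion it gives a contraction, rewritten it is the
  three-halves rate, and as a ratio of successive norms it tends to zero.\<close>

lemma local_step:
  assumes A2: "assumption_A2 f \<mu> \<eta>" and comp: "compact (sublevel f x\<^sub>0)"
    and x: "x \<in> sublevel f x\<^sub>0"
    and small: "norm (grad f x) < min ((0.2 * \<mu>)\<^sup>2 / K) \<eta>"
  shows "norm (grad f (ron_step f K (hess f x) x)) \<le> 25 / 12 * reg x / \<mu> * norm (grad f x)"
    and "5 * reg x \<le> \<mu>"
proof -
  have \<mu>: "0 < \<mu>"
    using A2 by (simp add: assumption_A2_def)
  have "(reg x)\<^sup>2 \<le> (0.2 * \<mu>)\<^sup>2"
    using small K_pos by (simp add: reg_squared field_simps)
  then have "reg x \<le> 0.2 * \<mu>"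
    by (rule power2_le_imp_le) (use \<mu> in simp)
  then show near: "5 * reg x \<le> \<mu>" by simp
  show "norm (grad f (ron_step f K (hess f x) x)) \<le> 25 / 12 * reg x / \<mu> * norm (grad f x)"
  proof (cases "grad f x = 0")
    case True
    then show ?thesis by (simp add: ron_step_def)
  next
    case g: False
    obtain m where m: "m \<in> minimizers f" "infdist x (minimizers f) = dist x m"
      using infdist_attains_inf[OF closed_minimizers minimizers_nonempty[OF comp]] by blast
    have growth: "\<mu> / 2 * (norm (m - x))\<^sup>2 \<le> f x - f m"
    proof -
      have "\<mu> / 2 * (infdist x (minimizers f))\<^sup>2 \<le> f x - f m"
        using A2 m(1) small unfolding assumption_A2_def by simp
      then show ?thesis
        by (simp only: m(2) dist_norm norm_minus_commute)
    qed
    have m_level: "m \<in> sublevel f x\<^sub>0"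
      using minimizer_le[OF m(1)] by (simp add: sublevel_def)
    have "norm (direction x) \<le> 9 / 7 * norm (grad f x) / \<mu>"
      using direction_bound_near_minimizer[OF g grad_minimizer[OF m(1)] x m_level \<mu> growth near] \<mu>
      by (simp add: field_simps)
    then have "3 / 2 * reg x * norm (direction x) \<le> 3 / 2 * reg x * (9 / 7 * norm (grad f x) / \<mu>)"
      using reg_nonneg[of x] by (intro mult_left_mono) auto
    also have "\<dots> = 27 / 14 * (reg x / \<mu> * norm (grad f x))"
      by simp
    also have "\<dots> \<le> 25 / 12 * (reg x / \<mu> * norm (grad f x))"
      using reg_nonneg[of x] \<mu> by (intro mult_right_mono) auto
    finally have "3 / 2 * reg x * norm (direction x) \<le> 25 / 12 * reg x / \<mu> * norm (grad f x)"
      by (simp only: times_divide_eq_left times_divide_eq_right mult.assoc)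
    with grad_after_step[OF g x step_stays_in_sublevel[OF g x]] show ?thesis
      unfolding ron_step_eq[OF g] by (rule order_trans)
  qed
qed

end

text \<open>The recursion is required only at points of the sublevel set, since only there is the oracle
  known to be exact; that it always applies is then a consequence.\<close>

locale newton_iteration =
  regularised_newton f x\<^sub>0 K
  for f :: "real ^ 'd \<Rightarrow> real" and x\<^sub>0 :: "real ^ 'd" and K :: real +
  fixes \<theta> :: "nat \<Rightarrow> real ^ 'd"
  assumes start: "\<theta> 0 = x\<^sub>0"
    and iterate: "\<And>n. \<theta> n \<in> sublevel f x\<^sub>0 \<Longrightarrow> \<theta> (Suc n) = ron_step f K (hess f (\<theta> n)) (\<theta> n)"
    and compact_sublevel: "compact (sublevel f x\<^sub>0)"
begin

lemma iterates_in_sublevel: "\<theta> n \<in> sublevel f x\<^sub>0"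
proof (induction n)
  case 0
  then show ?case by (simp add: start sublevel_def)
next
  case (Suc n)
  show ?case
  proof (cases "grad f (\<theta> n) = 0")
    case True
    then show ?thesis
      using iterate[OF Suc] Suc by (simp add: ron_step_def)
  next
    case False
    then show ?thesis
      using iterate[OF Suc] ron_step_eq step_stays_in_sublevel Suc by simp
  qed
qed

text \<open>If all gradients had norm at least \<open>c\<close>, each step would lower the value by a fixed amount:
  the decrease is at least a multiple of the squared next gradient over the regularisation, which
  is bounded on the compact sublevel set. This contradicts the existence of a minimizer.\<close>

lemma ex_small_grad:
  assumes c: "0 < c"
  shows "\<exists>n. norm (grad f (\<theta> n)) < c"
proof (rule ccontr)
  assume "\<not> ?thesis"
  then have large: "c \<le> norm (grad f (\<theta> n))" for n
    by (simp add: not_less)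
  have nz: "grad f (\<theta> n) \<noteq> 0" for n
    using large[of n] c by auto
  have "bounded (grad f ` sublevel f x\<^sub>0)"
    by (intro compact_imp_bounded compact_continuous_image continuous_on_grad compact_sublevel)
  then obtain G where G: "\<And>x. x \<in> sublevel f x\<^sub>0 \<Longrightarrow> norm (grad f x) \<le> G"
    by (auto simp: bounded_iff)
  define R where "R = 27 / 10 * sqrt (K * G)"
  have decrease: "c\<^sup>2 \<le> R * (f (\<theta> n) - f (\<theta> (Suc n)))" for n
  proof -
    have succ: "\<theta> (Suc n) = \<theta> n + direction (\<theta> n)"
      using iterate[OF iterates_in_sublevel] ron_step_eq[OF nz] by simp
    have le: "0 \<le> f (\<theta> n) - f (\<theta> (Suc n))"
    proof -
      have "0 \<le> 5 / 6 * 1 * (reg (\<theta> n) * (norm (direction (\<theta> n)))\<^sup>2)"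
        using reg_nonneg by simp
      then show ?thesis
        using descent_along_direction[OF nz, of 1 n] iterates_in_sublevel[of n]
          iterates_in_sublevel[of "Suc n"] succ by simp
    qed
    have "c\<^sup>2 \<le> (norm (grad f (\<theta> (Suc n))))\<^sup>2"
      using large c by (intro power_mono) auto
    also have "\<dots> \<le> 27 / 10 * reg (\<theta> n) * (f (\<theta> n) - f (\<theta> (Suc n)))"
      using descent_by_next_grad[OF nz iterates_in_sublevel] succ by simp
    also have "\<dots> \<le> R * (f (\<theta> n) - f (\<theta> (Suc n)))"
      using G[OF iterates_in_sublevel, of n] K_pos le
      by (intro mult_right_mono) (auto simp: R_def reg_def)
    finally show ?thesis .
  qed
  have sum: "n * c\<^sup>2 \<le> R * (f x\<^sub>0 - f (\<theta> n))" for n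
  proof (induction n)
    case (Suc n)
    then show ?case
      using decrease[of n] by (simp add: algebra_simps)
  qed (simp add: start)
  obtain m where m: "m \<in> minimizers f"
    using minimizers_nonempty[OF compact_sublevel] by blast
  have "0 \<le> G"
    using norm_ge_zero G[OF iterates_in_sublevel] by (rule order_trans)
  then have "0 \<le> R"
    using K_pos by (simp add: R_def)
  then have "R * (f x\<^sub>0 - f (\<theta> n)) \<le> R * (f x\<^sub>0 - f m)" for n
    using minimizer_le[OF m] by (intro mult_left_mono) auto
  then have "n * c\<^sup>2 \<le> R * (f x\<^sub>0 - f m)" for n :: nat
    using sum[of n] by (meson order_trans)
  moreover obtain n :: nat where "R * (f x\<^sub>0 - f m) < n * c\<^sup>2"
    using reals_Archimedean3[of "c\<^sup>2"] c by auto
  ultimately show False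
    by (simp add: leD)
qed

context
  fixes \<mu> \<eta> :: real
  assumes A2: "assumption_A2 f \<mu> \<eta>"
begin

lemma local_contraction:
  assumes "norm (grad f (\<theta> n)) < min ((0.2 * \<mu>)\<^sup>2 / K) \<eta>"
  shows "norm (grad f (\<theta> (Suc n))) \<le> 5 / 12 * norm (grad f (\<theta> n))"
proof -
  have \<mu>: "0 < \<mu>"
    using A2 by (simp add: assumption_A2_def)
  note local = local_step[OF A2 compact_sublevel iterates_in_sublevel assms]
  have "25 / 12 * reg (\<theta> n) / \<mu> \<le> 5 / 12"
    using local(2) \<mu> by (simp add: field_simps)
  then have "25 / 12 * reg (\<theta> n) / \<mu> * norm (grad f (\<theta> n)) \<le> 5 / 12 * norm (grad f (\<theta> n))"
    by (rule mult_right_mono) simp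
  then show ?thesis
    using local(1) unfolding iterate[OF iterates_in_sublevel] by (rule order_trans[rotated])
qed

lemma small_grad_persists:
  assumes "norm (grad f (\<theta> N)) < min ((0.2 * \<mu>)\<^sup>2 / K) \<eta>"
  shows "norm (grad f (\<theta> (N + k))) \<le> (5 / 12) ^ k * norm (grad f (\<theta> N))"
    and "norm (grad f (\<theta> (N + k))) < min ((0.2 * \<mu>)\<^sup>2 / K) \<eta>"
proof (induction k)
  case 0
  { case 1 then show ?case by simp }
  { case 2 then show ?case using assms by simp }
next
  case (Suc k)
  have *: "norm (grad f (\<theta> (N + Suc k))) \<le> 5 / 12 * norm (grad f (\<theta> (N + k)))"
    using local_contraction[OF Suc(2)] by simp
  { case 1 show ?case using * Suc(1) by simp }
  { case 2 show ?case
      using * Suc(2) norm_ge_zero[of "grad f (\<theta> (N + k))"] by linarith }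
qed

lemma local_three_halves_rate:
  assumes "norm (grad f (\<theta> N)) < min ((0.2 * \<mu>)\<^sup>2 / K) \<eta>" "N \<le> n"
  shows "norm (grad f (\<theta> (Suc n)))
    \<le> 25 / 12 * (sqrt K / \<mu>) * norm (grad f (\<theta> n)) powr (3 / 2)"
proof -
  have small: "norm (grad f (\<theta> n)) < min ((0.2 * \<mu>)\<^sup>2 / K) \<eta>"
    using small_grad_persists(2)[OF assms(1), of "n - N"] assms(2) by simp
  have "norm (grad f (\<theta> n)) powr (3 / 2) = norm (grad f (\<theta> n)) powr (1 + 1 / 2)"
    by simp
  also have "\<dots> = norm (grad f (\<theta> n)) * sqrt (norm (grad f (\<theta> n)))"
    by (subst powr_add) (simp add: powr_half_sqrt)
  finally have "25 / 12 * (sqrt K / \<mu>) * norm (grad f (\<theta> n)) powr (3 / 2)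
      = 25 / 12 * reg (\<theta> n) / \<mu> * norm (grad f (\<theta> n))"
    by (simp add: reg_def real_sqrt_mult)
  then show ?thesis
    using local_step(1)[OF A2 compact_sublevel iterates_in_sublevel small]
    by (simp only: iterate[OF iterates_in_sublevel])
qed

lemma grad_tendsto_0: "(\<lambda>n. norm (grad f (\<theta> n))) \<longlonglongrightarrow> 0"
proof -
  have "0 < min ((0.2 * \<mu>)\<^sup>2 / K) \<eta>"
    using A2 K_pos by (simp add: assumption_A2_def)
  then obtain N where N: "norm (grad f (\<theta> N)) < min ((0.2 * \<mu>)\<^sup>2 / K) \<eta>"
    using ex_small_grad by blast
  have geometric: "(\<lambda>k. (5 / 12) ^ k * norm (grad f (\<theta> N))) \<longlonglongrightarrow> 0"
    by (intro tendsto_mult_left_zero LIMSEQ_power_zero) auto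
  have "(\<lambda>k. norm (grad f (\<theta> (k + N)))) \<longlonglongrightarrow> 0"
  proof (rule tendsto_sandwich[OF _ _ tendsto_const geometric])
    show "eventually (\<lambda>k. norm (grad f (\<theta> (k + N))) \<le> (5 / 12) ^ k * norm (grad f (\<theta> N))) sequentially"
      using small_grad_persists(1)[OF N] by (simp add: add.commute)
  qed simp
  then show ?thesis
    by (rule LIMSEQ_offset)
qed

text \<open>The ratio of successive norms serves as \<open>\<rho>\<close>. Where the gradient vanishes the ratio is the
  default value zero, which is correct because the iteration then stays put.\<close>

lemma grad_superlinear: "converges_superlinearly_to_0 (\<lambda>n. norm (grad f (\<theta> n)))"
proof -
  let ?g = "\<lambda>n. norm (grad f (\<theta> n))"
  define \<rho> where "\<rho> n = ?g (Suc n) / ?g n" for n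
  have \<mu>: "0 < \<mu>"
    using A2 by (simp add: assumption_A2_def)
  have "?g (Suc n) \<le> \<rho> n * ?g n" for n
    using iterate[OF iterates_in_sublevel, of n]
    by (cases "grad f (\<theta> n) = 0") (auto simp: \<rho>_def ron_step_def)
  moreover have "\<rho> \<longlonglongrightarrow> 0"
  proof (rule tendsto_sandwich[OF _ _ tendsto_const])
    have "0 < min ((0.2 * \<mu>)\<^sup>2 / K) \<eta>"
      using A2 K_pos by (simp add: assumption_A2_def)
    then have "eventually (\<lambda>n. ?g n < min ((0.2 * \<mu>)\<^sup>2 / K) \<eta>) sequentially"
      by (rule order_tendstoD(2)[OF grad_tendsto_0])
    then show "eventually (\<lambda>n. \<rho> n \<le> 25 / 12 * reg (\<theta> n) / \<mu>) sequentially"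
    proof eventually_elim
      case (elim n)
      show ?case
        using local_step(1)[OF A2 compact_sublevel iterates_in_sublevel elim]
          iterate[OF iterates_in_sublevel, of n] reg_nonneg[of "\<theta> n"] \<mu>
        by (cases "grad f (\<theta> n) = 0") (auto simp: \<rho>_def divide_le_eq)
    qed
    have "(\<lambda>n. 25 / 12 * sqrt (K * ?g n) / \<mu>) \<longlonglongrightarrow> 25 / 12 * sqrt (K * 0) / \<mu>"
      by (intro tendsto_intros grad_tendsto_0) (use \<mu> in auto)
    then show "(\<lambda>n. 25 / 12 * reg (\<theta> n) / \<mu>) \<longlonglongrightarrow> 0"
      by (simp add: reg_def)
  qed (simp add: \<rho>_def)
  ultimately show ?thesis
    using grad_tendsto_0 unfolding converges_superlinearly_to_0_def by auto
qed

end

end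

section \<open>The iteration with a random oracle\<close>

lemma oracle_exact_on_sublevel:
  assumes "oracle_error f \<theta>\<^sub>0 \<Omega> B = 0" "\<omega> \<in> space \<Omega>" "\<theta> \<in> sublevel f \<theta>\<^sub>0"
  shows "B \<theta> \<omega> = hess f \<theta>"
proof -
  have "ennreal (spectral_norm (B \<theta> \<omega> - hess f \<theta>)) \<le> oracle_error f \<theta>\<^sub>0 \<Omega> B"
    unfolding oracle_error_def by (rule SUP_upper2[OF assms(2)]) (rule SUP_upper[OF assms(3)])
  then have "spectral_norm (B \<theta> \<omega> - hess f \<theta>) \<le> 0"
    by (simp add: assms(1) ennreal_eq_0_iff)
  then show ?thesis
    by (simp add: spectral_norm_le_0_iff)
qed

text \<open>A finite bound rules out the value \<open>\<infinity>\<close> of an empty infimum, so the threshold was reached.\<close>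

lemma hitting_time_leD:
  assumes "hitting_time f L\<^sub>H \<mu> \<eta> \<theta> \<gamma> \<le> enat n"
  obtains N where "N \<le> n" "norm (grad f (\<theta> N)) < min ((\<gamma> * \<mu>)\<^sup>2 / L\<^sub>H) \<eta>"
proof -
  have "hitting_time f L\<^sub>H \<mu> \<eta> \<theta> \<gamma> < enat (Suc n)"
    using assms by (rule le_less_trans) simp
  then obtain N where "N < Suc n" "norm (grad f (\<theta> N)) < min ((\<gamma> * \<mu>)\<^sup>2 / L\<^sub>H) \<eta>"
    unfolding hitting_time_def Inf_less_iff by auto
  then show thesis
    by (intro that[of N]) simp_all
qed

lemma gamma1_exact: "0 < \<mu> \<Longrightarrow> gamma1 \<mu> 0 = 0.2"
  by (simp add: gamma1_def)

lemma convex_sublevel: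
  assumes "convex_on UNIV f"
  shows "convex (sublevel f \<theta>\<^sub>0)"
proof (rule convexI)
  fix x y and u v :: real
  assume xy: "x \<in> sublevel f \<theta>\<^sub>0" "y \<in> sublevel f \<theta>\<^sub>0" and uv: "0 \<le> u" "0 \<le> v" "u + v = 1"
  then have "f (u *\<^sub>R x + v *\<^sub>R y) \<le> u * f x + v * f y"
    using assms by (simp add: convex_on_def)
  also have "\<dots> \<le> f \<theta>\<^sub>0"
    using xy uv by (intro convex_bound_le) (auto simp: sublevel_def)
  finally show "u *\<^sub>R x + v *\<^sub>R y \<in> sublevel f \<theta>\<^sub>0"
    by (simp add: sublevel_def)
qed

theorem corollary3p4:
  fixes f :: "real ^ 'd \<Rightarrow> real"
    and \<theta>\<^sub>0 :: "real ^ 'd"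
    and L L\<^sub>H D \<mu> \<eta> :: real
    and \<Omega> :: "'w measure"
    and B :: "real ^ 'd \<Rightarrow> 'w \<Rightarrow> real ^ 'd ^ 'd"
    and M :: "'p measure"
    and \<xi> :: "nat \<Rightarrow> 'p \<Rightarrow> 'w"
    and \<theta> :: "nat \<Rightarrow> 'p \<Rightarrow> real ^ 'd"
  assumes "assumption_A1 f \<theta>\<^sub>0 L L\<^sub>H D"
    and "assumption_A2 f \<mu> \<eta>"
    and "overestimation_oracle f \<Omega> B"
    and "ron_iteration f L\<^sub>H \<Omega> B M \<xi> \<theta>\<^sub>0 \<theta>"
    and "oracle_error f \<theta>\<^sub>0 \<Omega> B = 0"
  shows "AE x in M.
           (\<forall>n. hitting_time f L\<^sub>H \<mu> \<eta> (\<lambda>k. \<theta> k x)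
                  (gamma1 \<mu> (enn2real (oracle_error f \<theta>\<^sub>0 \<Omega> B))) \<le> enat n \<longrightarrow>
              norm (grad f (\<theta> (Suc n) x))
                \<le> 25 / 12 * (sqrt L\<^sub>H / \<mu>) * norm (grad f (\<theta> n x)) powr (3 / 2)) \<and>
           converges_superlinearly_to_0 (\<lambda>n. norm (grad f (\<theta> n x)))"
proof -
  note A1 = assms(1)[unfolded assumption_A1_def twice_continuously_differentiable_def]
  have \<mu>: "0 < \<mu>"
    using assms(2) by (simp add: assumption_A2_def)
  have newton: "regularised_newton f \<theta>\<^sub>0 L\<^sub>H"
    by unfold_locales (use A1 in \<open>auto intro: convex_sublevel\<close>)
  have \<xi>: "\<xi> n \<in> measurable M \<Omega>" for n
    using assms(4) by (simp add: ron_iteration_def)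
  have run: "AE x in M. \<theta> 0 x = \<theta>\<^sub>0 \<and>
        (\<forall>n. B (\<theta> n x) (\<xi> n x) \<succeq> hess f (\<theta> n x) \<and>
             \<theta> (Suc n) x = ron_step f L\<^sub>H (B (\<theta> n x) (\<xi> n x)) (\<theta> n x))"
    using assms(4) by (simp add: ron_iteration_def)
  show ?thesis
    using run AE_space
  proof eventually_elim
    case (elim x)
    interpret regularised_newton f \<theta>\<^sub>0 L\<^sub>H by (fact newton)
    interpret newton_iteration f \<theta>\<^sub>0 L\<^sub>H "\<lambda>n. \<theta> n x"
    proof
      fix n assume "\<theta> n x \<in> sublevel f \<theta>\<^sub>0"
      then have "B (\<theta> n x) (\<xi> n x) = hess f (\<theta> n x)"
        using oracle_exact_on_sublevel[OF assms(5)] measurable_space[OF \<xi>] elim by blast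
      then show "\<theta> (Suc n) x = ron_step f L\<^sub>H (hess f (\<theta> n x)) (\<theta> n x)"
        using elim by simp
    qed (use A1 elim in auto)
    show ?case
    proof (intro conjI allI impI)
      fix n
      assume "hitting_time f L\<^sub>H \<mu> \<eta> (\<lambda>k. \<theta> k x)
                (gamma1 \<mu> (enn2real (oracle_error f \<theta>\<^sub>0 \<Omega> B))) \<le> enat n"
      then have "hitting_time f L\<^sub>H \<mu> \<eta> (\<lambda>k. \<theta> k x) 0.2 \<le> enat n"
        by (simp only: assms(5) enn2real_0 gamma1_exact[OF \<mu>])
      then obtain N where "N \<le> n" "norm (grad f (\<theta> N x)) < min ((0.2 * \<mu>)\<^sup>2 / L\<^sub>H) \<eta>"
        by (rule hitting_time_leD)
      then show "norm (grad f (\<theta> (Suc n) x))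
          \<le> 25 / 12 * (sqrt L\<^sub>H / \<mu>) * norm (grad f (\<theta> n x)) powr (3 / 2)"
        using local_three_halves_rate[OF assms(2)] by blast
    next
      show "converges_superlinearly_to_0 (\<lambda>n. norm (grad f (\<theta> n x)))"
        by (rule grad_superlinear[OF assms(2)])
    qed
  qed
qed

end
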